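(* For each $t\in[0,1)$, both of the operators $C_t\colon H^\infty\to H^\infty$ and $C_t\colon A(\mathbb{D})\to A(\mathbb{D})$ are compact.
   Context: Let $\mathbb{D}=\{z\in\mathbb{C}:|z|<1\}$ and let $H(\mathbb{D})$ be the space of holomorphic functions on $\mathbb{D}$. $H^\infty$ is the Banach space of bounded $f\in H(\mathbb{D})$ with the norm $\|f\|_\infty=\sup_{z\in\mathbb{D}}|f(z)|$. The disc algebra $A(\mathbb{D})$ is its closed subspace of all $f\in H(\mathbb{D})$ that extend to a continuous function on $\overline{\mathbb{D}}$. For $t\in[0,1)$ the generalized Cesàro operator $C_t\colon H(\mathbb{D})\to H(\mathbb{D})$ is defined by $(C_tf)(0):=f(0)$ and $(C_tf)(z):=\frac1z\int_0^z\frac{f(\xi)}{1-t\xi}\,d\xi$ for $z\in\mathbb{D}\setminus\{0\}$; it maps $H^\infty$ into $H^\infty$ and $A(\mathbb{D})$ into $A(\mathbb{D})$. *)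

theory Defs
  imports "HOL-Complex_Analysis.Complex_Analysis"
begin

(* A function on the open unit disc D = ball 0 1 is represented by the total function that
   agrees with it on D and vanishes outside, so that equality of functions on D is equality
   in HOL and the pointwise vector space operations stay inside the spaces below. *)
definition hol_disc :: "(complex \<Rightarrow> complex) set" where
  "hol_disc = {f. f holomorphic_on ball 0 1 \<and> (\<forall>z. z \<notin> ball 0 1 \<longrightarrow> f z = 0)}"

definition Hinf :: "(complex \<Rightarrow> complex) set" where
  "Hinf = {f \<in> hol_disc. bounded (f ` ball 0 1)}"

(* The continuous extension to the closed disc is a separate function g: by the convention
   above, f itself is 0 on the unit circle. *)
definition disc_algebra :: "(complex \<Rightarrow> complex) set" where
  "disc_algebra =
     {f \<in> hol_disc. \<exists>g. continuous_on (cball 0 1) g \<and> (\<forall>z\<in>ball 0 1. g z = f z)}"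

(* The supremum of an unbounded set of reals has no specified sign, whereas Metric_space asks for
   a nonnegative distance on the whole type. The value 0 for unbounded functions meets this and is
   irrelevant on Hinf. *)
definition sup_norm :: "(complex \<Rightarrow> complex) \<Rightarrow> real" where
  "sup_norm f = (if bounded (f ` ball 0 1) then SUP z\<in>ball 0 1. cmod (f z) else 0)"

definition sup_dist :: "(complex \<Rightarrow> complex) \<Rightarrow> (complex \<Rightarrow> complex) \<Rightarrow> real" where
  "sup_dist f g = sup_norm (\<lambda>z. f z - g z)"

(* The integrand is holomorphic on D for f in hol_disc and 0 <= t < 1, so the integral from 0
   to z does not depend on the path; the segment is used. *)
definition Cesaro :: "real \<Rightarrow> (complex \<Rightarrow> complex) \<Rightarrow> complex \<Rightarrow> complex" where
  "Cesaro t f z =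
     (if z \<notin> ball 0 1 then 0
      else if z = 0 then f 0
      else 1 / z * contour_integral (linepath 0 z) (\<lambda>\<xi>. f \<xi> / (1 - of_real t * \<xi>)))"

definition linear_operator ::
  "(complex \<Rightarrow> complex) set \<Rightarrow> (complex \<Rightarrow> complex) set
     \<Rightarrow> ((complex \<Rightarrow> complex) \<Rightarrow> (complex \<Rightarrow> complex)) \<Rightarrow> bool" where
  "linear_operator X Y T \<longleftrightarrow>
     T \<in> X \<rightarrow> Y \<and>
     (\<forall>f\<in>X. \<forall>g\<in>X. \<forall>a b. T (\<lambda>z. a * f z + b * g z) = (\<lambda>z. a * T f z + b * T g z))"

(* For spaces X, Y of functions on D normed by the supremum norm: every bounded subset of X is
   mapped to a relatively compact subset of Y, the closure being taken in Y. *)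
definition compact_operator ::
  "(complex \<Rightarrow> complex) set \<Rightarrow> (complex \<Rightarrow> complex) set
     \<Rightarrow> ((complex \<Rightarrow> complex) \<Rightarrow> (complex \<Rightarrow> complex)) \<Rightarrow> bool" where
  "compact_operator X Y T \<longleftrightarrow>
     linear_operator X Y T \<and>
     (\<forall>B. Metric_space.mbounded X sup_dist B \<longrightarrow>
        compactin (Metric_space.mtopology Y sup_dist)
          (Metric_space.mtopology Y sup_dist closure_of (T ` B)))"

lemma disc_algebra_subset_Hinf: "disc_algebra \<subseteq> Hinf"
proof
  fix f assume "f \<in> disc_algebra"
  then obtain g where f: "f \<in> hol_disc" and g: "continuous_on (cball 0 1) g"
    and eq: "\<forall>z\<in>ball 0 1. g z = f z"
    by (auto simp: disc_algebra_def)
  have "bounded (g ` cball 0 1)"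
    by (intro compact_imp_bounded compact_continuous_image g compact_cball)
  moreover have "f ` ball 0 1 \<subseteq> g ` cball 0 1"
  proof
    fix w assume "w \<in> f ` ball 0 1"
    then obtain z where "z \<in> ball 0 1" "w = f z" by blast
    then have "w = g z" "z \<in> cball 0 1"
      using eq by auto
    then show "w \<in> g ` cball 0 1" by blast
  qed
  ultimately show "f \<in> Hinf"
    using f bounded_subset by (auto simp: Hinf_def)
qed

lemma sup_norm_upper:
  assumes "bounded (f ` ball 0 1)" "z \<in> ball 0 1"
  shows "cmod (f z) \<le> sup_norm f"
proof -
  have "bdd_above ((\<lambda>z. cmod (f z)) ` ball 0 1)"
    using assms(1) by (auto simp: bounded_iff bdd_above_def)
  then show ?thesis
    using cSUP_upper[OF assms(2)] assms(1) by (simp add: sup_norm_def)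
qed

lemma sup_norm_nonneg: "0 \<le> sup_norm f"
proof (cases "bounded (f ` ball 0 1)")
  case True
  from sup_norm_upper[OF this, of 0] show ?thesis
    using norm_ge_zero[of "f 0"] by (simp del: norm_ge_zero)
qed (simp add: sup_norm_def)

lemma bounded_diff_Hinf:
  assumes "f \<in> Hinf" "g \<in> Hinf"
  shows "bounded ((\<lambda>z. f z - g z) ` ball 0 1)"
  using assms bounded_minus_comp[of f "ball 0 1" g] by (simp add: Hinf_def)

lemma Metric_space_Hinf: "Metric_space Hinf sup_dist"
proof
  have le: "cmod (f z - g z) \<le> sup_dist f g"
    if "f \<in> Hinf" "g \<in> Hinf" "z \<in> ball 0 1" for f g z
    unfolding sup_dist_def
    using sup_norm_upper[OF bounded_diff_Hinf[OF that(1,2)] that(3)] .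
  fix f g
  show "0 \<le> sup_dist f g"
    by (simp add: sup_dist_def sup_norm_nonneg)
  show "sup_dist f g = sup_dist g f"
  proof -
    have "bounded ((\<lambda>z. f z - g z) ` ball 0 1) = bounded ((\<lambda>z. g z - f z) ` ball 0 1)"
      unfolding bounded_iff by (simp add: norm_minus_commute)
    then show ?thesis
      by (simp add: sup_dist_def sup_norm_def norm_minus_commute)
  qed
  show "sup_dist f g = 0 \<longleftrightarrow> f = g" if fg: "f \<in> Hinf" "g \<in> Hinf"
  proof
    assume 0: "sup_dist f g = 0"
    have "f z = g z" for z
    proof (cases "z \<in> ball 0 1")
      case True
      then show ?thesis using le[OF fg True] 0 by simp
    next
      case False
      then show ?thesis using fg by (simp add: Hinf_def hol_disc_def)
    qed
    then show "f = g" by auto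
  next
    assume "f = g"
    then show "sup_dist f g = 0"
      by (simp add: sup_dist_def sup_norm_def)
  qed
  fix h
  assume fgh: "f \<in> Hinf" "g \<in> Hinf" "h \<in> Hinf"
  have "cmod (f z - h z) \<le> sup_dist f g + sup_dist g h" if z: "z \<in> ball 0 1" for z
    using norm_triangle_ineq[of "f z - g z" "g z - h z"] le[OF fgh(1,2) z] le[OF fgh(2,3) z]
    by simp
  then have "(SUP z\<in>ball 0 1. cmod (f z - h z)) \<le> sup_dist f g + sup_dist g h"
    by (intro cSUP_least) auto
  then show "sup_dist f h \<le> sup_dist f g + sup_dist g h"
    using bounded_diff_Hinf[OF fgh(1,3)] by (simp add: sup_dist_def[of f h] sup_norm_def)
qed

lemma Metric_space_disc_algebra: "Metric_space disc_algebra sup_dist"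
  using Metric_space.subspace[OF Metric_space_Hinf disc_algebra_subset_Hinf] .

end

theory Submission
  imports Defs
begin

text \<open>
  The kernel \<open>1 / (1 - t \<xi>)\<close> is bounded on the disc because \<^term>\<open>t < (1::real)\<close>, so for bounded
  \<open>f\<close> the function \<open>z (C\<^sub>t f)(z)\<close> has a bounded derivative. Dividing by \<open>z\<close> does no harm: near
  the unit circle \<open>1/z\<close> is bounded, and near the origin the singularity is removable.
  Quantitatively, if \<open>|f| \<le> M\<close> then \<open>C\<^sub>t f\<close> is bounded by \<open>M / (1 - t)\<close> and Lipschitz with
  constant \<open>4 M / (1 - t)\<close> on the whole disc (\<open>cmod_Cesaro_le\<close>, \<open>Cesaro_lipschitz\<close>).

  A bounded set is therefore mapped into a set of holomorphic functions with a common bound and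
  a common Lipschitz constant. Such functions extend continuously to the closed disc, where
  the theorem of Arzela and Ascoli applies; the class is closed under uniform limits, so it is
  compact in the supremum norm (\<open>compactin_lipschitz_disc\<close>). It lies inside the disc algebra,
  hence is compact in either of the two spaces, and being closed it contains the closure of the
  image.
\<close>

section \<open>Holomorphy and linearity of the operators\<close>

lemma one_minus_bound:
  assumes "0 \<le> t" "t < 1" "z \<in> ball 0 1"
  shows "1 - t \<le> cmod (1 - of_real t * z)"
proof -
  have "cmod (of_real t * z) \<le> t"
    using assms by (simp add: norm_mult mult_left_le)
  then show ?thesis
    using norm_triangle_ineq2[of 1 "of_real t * z"] by simp
qed

lemma holomorphic_Cesaro_integrand:
  assumes "0 \<le> t" "t < 1" "f holomorphic_on ball 0 1"
  shows "(\<lambda>z. f z / (1 - of_real t * z)) holomorphic_on ball 0 1"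
proof -
  have "1 - of_real t * z \<noteq> 0" if "z \<in> ball 0 1" for z :: complex
    using one_minus_bound[OF assms(1,2) that] assms(2) by auto
  then show ?thesis
    using assms(3) by (intro holomorphic_intros) auto
qed

lemma Cesaro_primitive:
  assumes t: "0 \<le> t" "t < 1" and f: "f holomorphic_on ball 0 1"
  obtains F where
    "\<And>z. z \<in> ball 0 1 \<Longrightarrow> (F has_field_derivative f z / (1 - of_real t * z)) (at z)"
    "\<And>z. z \<in> ball 0 1 \<Longrightarrow>
       ((\<lambda>\<xi>. f \<xi> / (1 - of_real t * \<xi>)) has_contour_integral F z) (linepath 0 z)"
    "F 0 = 0"
    "\<And>z. z \<in> ball 0 1 \<Longrightarrow> z \<noteq> 0 \<Longrightarrow> Cesaro t f z = F z / z"
proof -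
  let ?h = "\<lambda>\<xi>. f \<xi> / (1 - of_real t * \<xi>)"
  obtain G where G: "\<And>z. z \<in> ball 0 1 \<Longrightarrow> (G has_field_derivative ?h z) (at z within ball 0 1)"
    using holomorphic_convex_primitive'[OF convex_ball open_ball holomorphic_Cesaro_integrand[OF t f]]
    by blast
  define F where "F z = G z - G 0" for z
  have int: "(?h has_contour_integral F z) (linepath 0 z)" if "z \<in> ball 0 1" for z
  proof -
    have "path_image (linepath 0 z) \<subseteq> ball 0 1"
      using that by (simp add: closed_segment_subset)
    from contour_integral_primitive[OF G valid_path_linepath this] show ?thesis
      by (simp add: F_def)
  qed
  show thesis
  proof (rule that)
    show "(F has_field_derivative ?h z) (at z)" if "z \<in> ball 0 1" for z
      using G[OF that] that unfolding F_def
      by (auto intro!: derivative_eq_intros simp: at_within_open[OF that open_ball])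
    show "(?h has_contour_integral F z) (linepath 0 z)" if "z \<in> ball 0 1" for z
      by (rule int[OF that])
    show "F 0 = 0"
      by (simp add: F_def)
    show "Cesaro t f z = F z / z" if "z \<in> ball 0 1" "z \<noteq> 0" for z
      using that contour_integral_unique[OF int[OF that(1)]] by (simp add: Cesaro_def)
  qed
qed

text \<open>
  Off the origin \<^term>\<open>Cesaro t f\<close> is the difference quotient at 0 of a primitive of the integrand,
  and the prescribed value at 0 is the derivative of that primitive there, so the singularity of
  the quotient is the removable one.
\<close>
lemma Cesaro_hol_disc:
  assumes t: "0 \<le> t" "t < 1" and f: "f \<in> hol_disc"
  shows "Cesaro t f \<in> hol_disc"
proof -
  have hol: "f holomorphic_on ball 0 1"
    using f by (simp add: hol_disc_def)
  obtain F where F: "\<And>z. z \<in> ball 0 1 \<Longrightarrow> (F has_field_derivative f z / (1 - of_real t * z)) (at z)"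
    and F0: "F 0 = 0"
    and C: "\<And>z. z \<in> ball 0 1 \<Longrightarrow> z \<noteq> 0 \<Longrightarrow> Cesaro t f z = F z / z"
    using Cesaro_primitive[OF t hol] by metis
  have "F holomorphic_on ball 0 1"
    using F unfolding holomorphic_on_open[OF open_ball] by blast
  then have "(\<lambda>z. if z = 0 then deriv F 0 else (F z - F 0) / (z - 0)) holomorphic_on ball 0 1"
    by (rule pole_lemma_open) simp
  moreover have "(if z = 0 then deriv F 0 else (F z - F 0) / (z - 0)) = Cesaro t f z"
    if "z \<in> ball 0 1" for z
  proof (cases "z = 0")
    case True
    then show ?thesis
      using DERIV_imp_deriv[OF F[of 0]] by (simp add: Cesaro_def)
  next
    case False
    then show ?thesis
      using C[OF that] F0 by simp
  qed
  ultimately have "Cesaro t f holomorphic_on ball 0 1"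
    by (rule holomorphic_transform)
  then show ?thesis
    by (simp add: hol_disc_def Cesaro_def)
qed

lemma Cesaro_linear_combination:
  assumes t: "0 \<le> t" "t < 1" and f: "f \<in> hol_disc" and g: "g \<in> hol_disc"
  shows "Cesaro t (\<lambda>z. a * f z + b * g z) = (\<lambda>z. a * Cesaro t f z + b * Cesaro t g z)"
proof
  fix z
  show "Cesaro t (\<lambda>z. a * f z + b * g z) z = a * Cesaro t f z + b * Cesaro t g z"
  proof (cases "z \<in> ball 0 1 \<and> z \<noteq> 0")
    case False
    then show ?thesis by (auto simp: Cesaro_def)
  next
    case True
    then have z: "z \<in> ball 0 1" "z \<noteq> 0" by auto
    have int: "(\<lambda>\<xi>. u \<xi> / (1 - of_real t * \<xi>)) contour_integrable_on linepath 0 z"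
      if "u \<in> hol_disc" for u
    proof -
      have "u holomorphic_on ball 0 1"
        using that by (simp add: hol_disc_def)
      from Cesaro_primitive[OF t this] show ?thesis
        using z(1) by (metis contour_integrable_on_def)
    qed
    have eq: "(a * f \<xi> + b * g \<xi>) / (1 - of_real t * \<xi>) =
        a * (f \<xi> / (1 - of_real t * \<xi>)) + b * (g \<xi> / (1 - of_real t * \<xi>))" for \<xi>
      by (simp add: add_divide_distrib)
    have "contour_integral (linepath 0 z) (\<lambda>\<xi>. (a * f \<xi> + b * g \<xi>) / (1 - of_real t * \<xi>)) =
        a * contour_integral (linepath 0 z) (\<lambda>\<xi>. f \<xi> / (1 - of_real t * \<xi>)) +
        b * contour_integral (linepath 0 z) (\<lambda>\<xi>. g \<xi> / (1 - of_real t * \<xi>))"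
      unfolding eq contour_integral_add[OF contour_integrable_lmul[OF int[OF f]]
          contour_integrable_lmul[OF int[OF g]]]
        contour_integral_lmul[OF int[OF f]] contour_integral_lmul[OF int[OF g]] ..
    then show ?thesis
      using z by (simp add: Cesaro_def algebra_simps)
  qed
qed

section \<open>The operators map bounded functions to Lipschitz functions\<close>

lemma cmod_Cesaro_le:
  assumes t: "0 \<le> t" "t < 1" and f: "f \<in> hol_disc"
    and M: "\<And>z. z \<in> ball 0 1 \<Longrightarrow> cmod (f z) \<le> M" and z: "z \<in> ball 0 1"
  shows "cmod (f z / (1 - of_real t * z)) \<le> M / (1 - t)"
    and "cmod (Cesaro t f z) \<le> M / (1 - t)"
proof -
  have M0: "0 \<le> M"
    using M[of 0] norm_ge_zero[of "f 0"] by (simp del: norm_ge_zero)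
  have h: "cmod (f w / (1 - of_real t * w)) \<le> M / (1 - t)" if "w \<in> ball 0 1" for w
    unfolding norm_divide
    using M[OF that] one_minus_bound[OF t that] M0 t(2) by (intro frac_le) auto
  show "cmod (f z / (1 - of_real t * z)) \<le> M / (1 - t)"
    by (rule h[OF z])
  have hol: "f holomorphic_on ball 0 1"
    using f by (simp add: hol_disc_def)
  obtain F where int: "\<And>z. z \<in> ball 0 1 \<Longrightarrow>
      ((\<lambda>\<xi>. f \<xi> / (1 - of_real t * \<xi>)) has_contour_integral F z) (linepath 0 z)"
    and C: "\<And>z. z \<in> ball 0 1 \<Longrightarrow> z \<noteq> 0 \<Longrightarrow> Cesaro t f z = F z / z"
    using Cesaro_primitive[OF t hol] by metis
  show "cmod (Cesaro t f z) \<le> M / (1 - t)"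
  proof (cases "z = 0")
    case True
    then show ?thesis
      using h[of 0] by (simp add: Cesaro_def)
  next
    case False
    have seg: "closed_segment 0 z \<subseteq> ball 0 1"
      using z by (simp add: closed_segment_subset)
    have "0 \<le> M / (1 - t)"
      using M0 t(2) by simp
    then have "cmod (F z) \<le> M / (1 - t) * cmod (z - 0)"
      using h seg by (intro has_contour_integral_bound_linepath[OF int[OF z]]) blast+
    then show ?thesis
      using False by (simp add: C[OF z] norm_divide divide_le_eq)
  qed
qed

text \<open>
  Write \<open>G\<close> for \<^term>\<open>Cesaro t f\<close>, \<open>h\<close> for the integrand and \<open>K\<close> for a common bound of the two.
  Differentiating \<open>z G(z)\<close> gives \<open>G(z) + z G'(z) = h(z)\<close>, hence the bound \<open>2 K / |z|\<close> for the
  derivative, which is useful away from the origin; near the origin Cauchy's inequality takes over.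
  The point is that no boundary behaviour of \<open>f\<close> enters: integration gains one derivative up to
  the boundary.
\<close>
lemma Cesaro_lipschitz:
  assumes t: "0 \<le> t" "t < 1" and f: "f \<in> hol_disc"
    and M: "\<And>z. z \<in> ball 0 1 \<Longrightarrow> cmod (f z) \<le> M"
  shows "(4 * (M / (1 - t)))-lipschitz_on (ball 0 1) (Cesaro t f)"
proof -
  let ?G = "Cesaro t f" and ?h = "\<lambda>z. f z / (1 - of_real t * z)" and ?K = "M / (1 - t)"
  have holf: "f holomorphic_on ball 0 1" and holG: "?G holomorphic_on ball 0 1"
    using f Cesaro_hol_disc[OF t f] by (simp_all add: hol_disc_def)
  have h_le: "cmod (?h z) \<le> ?K" and G_le: "cmod (?G z) \<le> ?K" if "z \<in> ball 0 1" for z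
    using cmod_Cesaro_le[OF t f _ that] M by blast+
  have G': "(?G has_field_derivative deriv ?G z) (at z)" if "z \<in> ball 0 1" for z
    using holomorphic_derivI[OF holG open_ball that] .
  obtain F where F: "\<And>z. z \<in> ball 0 1 \<Longrightarrow> (F has_field_derivative ?h z) (at z)"
    and F0: "F 0 = 0" and C: "\<And>z. z \<in> ball 0 1 \<Longrightarrow> z \<noteq> 0 \<Longrightarrow> ?G z = F z / z"
    using Cesaro_primitive[OF t holf] by metis
  have F_eq: "F z = z * ?G z" if "z \<in> ball 0 1" for z
    using C[OF that] F0 by (cases "z = 0") auto
  have ode: "z * deriv ?G z = ?h z - ?G z" if z: "z \<in> ball 0 1" for z
  proof -
    have "((\<lambda>z. z * ?G z) has_field_derivative z * deriv ?G z + 1 * ?G z) (at z)"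
      using DERIV_mult[OF DERIV_ident G'[OF z]] by (simp add: algebra_simps)
    then have "(F has_field_derivative z * deriv ?G z + 1 * ?G z) (at z)"
      by (rule has_field_derivative_transform_within_open[OF _ open_ball z]) (simp add: F_eq)
    from DERIV_unique[OF F[OF z] this] show ?thesis
      by (simp add: algebra_simps)
  qed
  have deriv_le: "cmod (deriv ?G z) \<le> 4 * ?K" if z: "z \<in> ball 0 1" for z
  proof (cases "cmod z < 1 / 2")
    case True
    \<comment> \<open>The radius 1/4 gives the same constant 4 as the bound \<open>2 K / |z|\<close> gives for \<open>|z| \<ge> 1/2\<close>.\<close>
    have sub: "cball z (1 / 4) \<subseteq> ball 0 1"
    proof
      fix w assume "w \<in> cball z (1 / 4)"
      then have "cmod (w - z) \<le> 1 / 4"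
        by (simp add: dist_norm norm_minus_commute)
      then show "w \<in> ball 0 1"
        using norm_triangle_ineq[of "w - z" z] True by simp
    qed
    have "cmod ((deriv ^^ 1) ?G z) \<le> fact 1 * ?K / (1 / 4) ^ 1"
    proof (rule Cauchy_inequality)
      show "?G holomorphic_on ball z (1 / 4)"
        using holG sub ball_subset_cball by (blast intro: holomorphic_on_subset)
      show "continuous_on (cball z (1 / 4)) ?G"
        using holG sub by (blast intro: holomorphic_on_subset holomorphic_on_imp_continuous_on)
      show "cmod (?G w) \<le> ?K" if "cmod (z - w) = 1 / 4" for w
      proof -
        have "w \<in> ball 0 1"
          using that by (intro subsetD[OF sub]) (simp add: dist_norm)
        then show ?thesis
          by (rule G_le)
      qed
    qed simp
    then show ?thesis by (simp add: mult.commute)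
  next
    case False
    have "cmod z * cmod (deriv ?G z) \<le> ?K + ?K"
      unfolding norm_mult[symmetric] ode[OF z]
      using norm_triangle_ineq4 add_mono[OF h_le[OF z] G_le[OF z]] by (rule order_trans)
    moreover have "1 / 2 * cmod (deriv ?G z) \<le> cmod z * cmod (deriv ?G z)"
      using False by (intro mult_right_mono) auto
    ultimately show ?thesis by simp
  qed
  show ?thesis
  proof (rule lipschitz_onI)
    show "dist (?G x) (?G y) \<le> 4 * ?K * dist x y" if "x \<in> ball 0 1" "y \<in> ball 0 1" for x y
      unfolding dist_norm
      using G' deriv_le that
      by (intro field_differentiable_bound[of "ball 0 1" ?G "deriv ?G"])
        (auto intro: has_field_derivative_at_within)
    have "0 \<le> cmod (deriv ?G 0)" by simp
    also have "\<dots> \<le> 4 * ?K" by (rule deriv_le) simp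
    finally show "0 \<le> 4 * ?K" .
  qed
qed

section \<open>Compactness of sets of Lipschitz functions\<close>

definition lipschitz_disc :: "real \<Rightarrow> (complex \<Rightarrow> complex) set" where
  "lipschitz_disc L =
     {g \<in> hol_disc. (\<forall>z\<in>ball 0 1. cmod (g z) \<le> L) \<and> L-lipschitz_on (ball 0 1) g}"

lemma lipschitz_disc_extension:
  assumes "g \<in> lipschitz_disc L"
  obtains e where "L-lipschitz_on (cball 0 1) e" "\<And>z. z \<in> ball 0 1 \<Longrightarrow> e z = g z"
    "\<And>z. z \<in> cball 0 1 \<Longrightarrow> cmod (e z) \<le> L"
proof -
  have "L-lipschitz_on (ball 0 1) g"
    using assms by (simp add: lipschitz_disc_def)
  from lipschitz_extend_closure[OF this]
  obtain e where e: "L-lipschitz_on (closure (ball 0 1)) e" "\<And>z. z \<in> ball 0 1 \<Longrightarrow> e z = g z"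
    by blast
  have cont: "continuous_on (closure (ball 0 1)) e"
    using e(1) by (rule lipschitz_on_continuous_on)
  have "cmod (e z) \<le> L" if "z \<in> closure (ball 0 1)" for z
    using assms e(2) by (intro continuous_on_closure_norm_le[OF cont _ that])
      (simp add: lipschitz_disc_def)
  then show thesis
    using that[of e] e by (simp add: closure_ball)
qed

lemma lipschitz_disc_subset_disc_algebra: "lipschitz_disc L \<subseteq> disc_algebra"
proof
  fix g assume g: "g \<in> lipschitz_disc L"
  then obtain e where e: "L-lipschitz_on (cball 0 1) e" "\<And>z. z \<in> ball 0 1 \<Longrightarrow> e z = g z"
    using lipschitz_disc_extension by metis
  have "g \<in> hol_disc"
    using g by (simp add: lipschitz_disc_def)
  moreover have "continuous_on (cball 0 1) e"
    using e(1) by (rule lipschitz_on_continuous_on)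
  ultimately show "g \<in> disc_algebra"
    using e(2) by (auto simp: disc_algebra_def)
qed

lemma lipschitz_disc_pointwise_limit:
  assumes f: "\<And>n. f n \<in> lipschitz_disc L" and g: "g \<in> hol_disc"
    and lim: "\<And>z. z \<in> ball 0 1 \<Longrightarrow> (\<lambda>n. f n z) \<longlonglongrightarrow> g z"
  shows "g \<in> lipschitz_disc L"
proof -
  have bd: "cmod (f n z) \<le> L" if "z \<in> ball 0 1" for n z
    using f[of n] that by (simp add: lipschitz_disc_def)
  have lip: "L-lipschitz_on (ball 0 1) (f n)" for n
    using f[of n] by (simp add: lipschitz_disc_def)
  have "cmod (g z) \<le> L" if "z \<in> ball 0 1" for z
    using bd[OF that] by (intro Lim_bounded[OF tendsto_norm[OF lim[OF that]]]) blast
  moreover have "L-lipschitz_on (ball 0 1) g"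
  proof (rule lipschitz_onI)
    fix x y :: complex assume xy: "x \<in> ball 0 1" "y \<in> ball 0 1"
    show "dist (g x) (g y) \<le> L * dist x y"
      using lipschitz_onD[OF lip xy]
      by (intro Lim_bounded[OF tendsto_dist[OF lim[OF xy(1)] lim[OF xy(2)]]]) blast
  qed (rule lipschitz_on_nonneg[OF lip])
  ultimately show ?thesis
    using g by (simp add: lipschitz_disc_def)
qed

lemma sup_dist_le:
  assumes "\<And>z. z \<in> ball 0 1 \<Longrightarrow> cmod (f z - g z) \<le> e"
  shows "sup_dist f g \<le> e"
proof -
  have "bounded ((\<lambda>z. f z - g z) ` ball 0 1)"
    using assms by (intro boundedI[where B = e]) auto
  moreover have "(SUP z\<in>ball 0 1. cmod (f z - g z)) \<le> e"
    using assms by (intro cSUP_least) auto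
  ultimately show ?thesis
    by (simp add: sup_dist_def sup_norm_def)
qed

text \<open>
  The theorem of Arzela and Ascoli needs a compact domain, so it is applied to the extensions to the
  closed disc, which inherit the bound and the Lipschitz constant. Restricting the uniform limit
  to the open disc gives a holomorphic function in the same class.
\<close>
lemma lipschitz_disc_subsequence:
  assumes f: "\<And>n. f n \<in> lipschitz_disc L"
  obtains g r where "g \<in> lipschitz_disc L" "strict_mono (r :: nat \<Rightarrow> nat)"
    "(\<lambda>n. sup_dist (f (r n)) g) \<longlonglongrightarrow> 0"
proof -
  have "\<exists>e. L-lipschitz_on (cball 0 1) e \<and> (\<forall>z\<in>ball 0 1. e z = f n z) \<and>
      (\<forall>z\<in>cball 0 1. cmod (e z) \<le> L)" for n
    using lipschitz_disc_extension[OF f[of n]] by metis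
  then obtain E where E: "\<And>n. L-lipschitz_on (cball 0 1) (E n)"
    "\<And>n z. z \<in> ball 0 1 \<Longrightarrow> E n z = f n z" "\<And>n z. z \<in> cball 0 1 \<Longrightarrow> cmod (E n z) \<le> L"
    by metis
  have L: "0 \<le> L"
    using lipschitz_on_nonneg[OF E(1)] .
  have equi: "\<exists>d>0. \<forall>n y. y \<in> cball 0 1 \<and> cmod (x - y) < d \<longrightarrow> cmod (E n x - E n y) < e"
    if x: "x \<in> cball 0 1" and e: "0 < e" for x e
  proof (intro exI conjI allI impI)
    \<comment> \<open>The 1 added to the constant covers the case that it is 0.\<close>
    show "0 < e / (L + 1)"
      using e L by simp
    fix n y assume y: "y \<in> cball 0 1 \<and> cmod (x - y) < e / (L + 1)"
    have "cmod (E n x - E n y) \<le> L * cmod (x - y)"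
      using lipschitz_onD[OF E(1) x, of y n] y by (simp add: dist_norm)
    also have "\<dots> \<le> L * (e / (L + 1))"
      using y L by (intro mult_left_mono) auto
    also have "\<dots> < e"
      using L e by (simp add: field_simps)
    finally show "cmod (E n x - E n y) < e" .
  qed
  obtain G r where "continuous_on (cball 0 1) G" and r: "strict_mono (r :: nat \<Rightarrow> nat)"
    and conv: "\<And>e. 0 < e \<Longrightarrow> \<exists>N. \<forall>n x. n \<ge> N \<and> x \<in> cball 0 1 \<longrightarrow> cmod (E (r n) x - G x) < e"
    by (rule Arzela_Ascoli[OF compact_cball E(3) equi]) blast+
  define g where "g z = (if z \<in> ball 0 1 then G z else 0)" for z
  have conv': "\<exists>N. \<forall>n\<ge>N. \<forall>z\<in>ball 0 1. dist (f (r n) z) (g z) < e" if "0 < e" for e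
  proof -
    obtain N where N: "\<And>n z. n \<ge> N \<Longrightarrow> z \<in> cball 0 1 \<Longrightarrow> cmod (E (r n) z - G z) < e"
      using conv[OF \<open>0 < e\<close>] by blast
    have "dist (f (r n) z) (g z) < e" if "n \<ge> N" "z \<in> ball 0 1" for n z
      using N[OF that(1), of z] E(2)[OF that(2), of "r n"] that(2) by (simp add: g_def dist_norm)
    then show ?thesis by blast
  qed
  then have unif: "uniform_limit (ball 0 1) (\<lambda>n. f (r n)) g sequentially"
    by (simp add: uniform_limit_sequentially_iff)
  have "g holomorphic_on ball 0 1"
  proof (rule holomorphic_uniform_sequence[OF open_ball])
    show "f (r n) holomorphic_on ball 0 1" for n
      using f[of "r n"] by (simp add: lipschitz_disc_def hol_disc_def)
    fix x :: complex assume "x \<in> ball 0 1"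
    then have "\<exists>d>0. cball x d \<subseteq> ball 0 1"
      using open_contains_cball_eq[OF open_ball] by blast
    then obtain d where "0 < d" "cball x d \<subseteq> ball 0 1"
      by blast
    then show "\<exists>d>0. cball x d \<subseteq> ball 0 1 \<and>
        uniform_limit (cball x d) (\<lambda>n. f (r n)) g sequentially"
      using uniform_limit_on_subset[OF unif, of "cball x d"] by blast
  qed
  then have "g \<in> hol_disc"
    by (simp add: hol_disc_def g_def)
  then have "g \<in> lipschitz_disc L"
    using lipschitz_disc_pointwise_limit[of "\<lambda>n. f (r n)"] f tendsto_uniform_limitI[OF unif]
    by blast
  moreover have "(\<lambda>n. sup_dist (f (r n)) g) \<longlonglongrightarrow> 0"
  proof (rule LIMSEQ_I)
    fix e :: real assume e: "0 < e"
    from conv'[of "e / 2"] e obtain N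
      where N: "\<forall>n\<ge>N. \<forall>z\<in>ball 0 1. dist (f (r n) z) (g z) < e / 2" by auto
    have "norm (sup_dist (f (r n)) g - 0) < e" if "N \<le> n" for n
    proof -
      have "sup_dist (f (r n)) g \<le> e / 2"
        using N that by (intro sup_dist_le) (simp add: dist_norm less_imp_le)
      moreover have "0 \<le> sup_dist (f (r n)) g"
        by (simp add: sup_dist_def sup_norm_nonneg)
      ultimately show ?thesis
        using e by simp
    qed
    then show "\<exists>N. \<forall>n\<ge>N. norm (sup_dist (f (r n)) g - 0) < e"
      by blast
  qed
  ultimately show thesis
    using that r by blast
qed

lemma compactin_lipschitz_disc:
  assumes "disc_algebra \<subseteq> Y" "Y \<subseteq> Hinf"
  shows "compactin (Metric_space.mtopology Y sup_dist) (lipschitz_disc L)"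
proof -
  interpret Metric_space Y sup_dist
    using Metric_space.subspace[OF Metric_space_Hinf assms(2)] .
  have sub: "lipschitz_disc L \<subseteq> Y"
    using lipschitz_disc_subset_disc_algebra assms(1) by blast
  have "\<exists>l r. l \<in> lipschitz_disc L \<and> strict_mono r \<and> limitin mtopology (\<sigma> \<circ> r) l sequentially"
    if \<sigma>: "range \<sigma> \<subseteq> lipschitz_disc L" for \<sigma> :: "nat \<Rightarrow> complex \<Rightarrow> complex"
  proof -
    have "\<And>n. \<sigma> n \<in> lipschitz_disc L"
      using \<sigma> by auto
    then obtain g r where g: "g \<in> lipschitz_disc L" "strict_mono (r :: nat \<Rightarrow> nat)"
      and lim: "(\<lambda>n. sup_dist (\<sigma> (r n)) g) \<longlonglongrightarrow> 0"
      using lipschitz_disc_subsequence[of \<sigma> L] by metis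
    have "\<sigma> n \<in> Y" "g \<in> Y" for n
      using \<sigma> sub g(1) by auto
    then have "limitin mtopology (\<sigma> \<circ> r) g sequentially"
      using lim by (simp add: limitin_metric_dist_null)
    then show ?thesis
      using g by blast
  qed
  then show ?thesis
    using sub by (simp add: compactin_sequentially)
qed

section \<open>Compactness of the operators\<close>

lemma mbounded_sup_dist_imp_uniform_bound:
  assumes X: "X \<subseteq> Hinf" and B: "Metric_space.mbounded X sup_dist B"
  obtains M where "B \<subseteq> X" "\<And>f z. f \<in> B \<Longrightarrow> z \<in> ball 0 1 \<Longrightarrow> cmod (f z) \<le> M"
proof -
  interpret Metric_space X sup_dist
    using Metric_space.subspace[OF Metric_space_Hinf X] .
  obtain c r where sub: "B \<subseteq> mcball c r"
    using B by (auto simp: mbounded_def)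
  have "cmod (f z) \<le> sup_norm c + r" if f: "f \<in> B" and z: "z \<in> ball 0 1" for f z
  proof -
    have H: "c \<in> Hinf" "f \<in> Hinf" "sup_dist c f \<le> r"
      using subsetD[OF sub f] subsetD[OF X] by simp_all
    have "cmod (c z - f z) \<le> r"
      using sup_norm_upper[OF bounded_diff_Hinf[OF H(1,2)] z] H(3) by (simp add: sup_dist_def)
    moreover have "cmod (c z) \<le> sup_norm c"
      using sup_norm_upper[of c z] H(1) z by (simp add: Hinf_def)
    ultimately show ?thesis
      using norm_triangle_ineq2[of "f z" "c z"] by (simp add: norm_minus_commute)
  qed
  moreover have "B \<subseteq> X"
    using sub by auto
  ultimately show thesis
    using that by blast
qed

lemma Cesaro_in_lipschitz_disc:
  assumes t: "0 \<le> t" "t < 1" and f: "f \<in> hol_disc"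
    and M: "\<And>z. z \<in> ball 0 1 \<Longrightarrow> cmod (f z) \<le> M"
  shows "Cesaro t f \<in> lipschitz_disc (4 * (M / (1 - t)))"
proof -
  have "0 \<le> M"
    using M[of 0] norm_ge_zero[of "f 0"] by (simp del: norm_ge_zero)
  then have "M / (1 - t) \<le> 4 * (M / (1 - t))"
    using t(2) by (simp add: divide_right_mono)
  then have "cmod (Cesaro t f z) \<le> 4 * (M / (1 - t))" if "z \<in> ball 0 1" for z
    using cmod_Cesaro_le(2)[OF t f M that] by (rule order_trans[rotated])
  then show ?thesis
    using Cesaro_hol_disc[OF t f] Cesaro_lipschitz[OF t f M] by (simp add: lipschitz_disc_def)
qed

lemma Cesaro_Hinf_disc_algebra:
  assumes t: "0 \<le> t" "t < 1" and f: "f \<in> Hinf"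
  shows "Cesaro t f \<in> disc_algebra"
proof -
  have f': "f \<in> hol_disc" "bounded (f ` ball 0 1)"
    using f by (auto simp: Hinf_def)
  have "Cesaro t f \<in> lipschitz_disc (4 * (sup_norm f / (1 - t)))"
    using Cesaro_in_lipschitz_disc[OF t f'(1) sup_norm_upper[OF f'(2)]] .
  then show ?thesis
    using lipschitz_disc_subset_disc_algebra by blast
qed

text \<open>
  Since all bounded holomorphic functions are sent into the disc algebra, one argument serves every
  domain of bounded functions and every target between the disc algebra and the bounded functions.
\<close>
lemma compact_operator_Cesaro:
  assumes t: "0 \<le> t" "t < 1" and X: "X \<subseteq> Hinf" and Y: "disc_algebra \<subseteq> Y" "Y \<subseteq> Hinf"
  shows "compact_operator X Y (Cesaro t)"
  unfolding compact_operator_def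
proof (intro conjI allI impI)
  have Xhol: "X \<subseteq> hol_disc"
    using X by (auto simp: Hinf_def)
  show "linear_operator X Y (Cesaro t)"
    unfolding linear_operator_def
    using Cesaro_linear_combination[OF t] Cesaro_Hinf_disc_algebra[OF t] X Y(1) Xhol
    by (auto simp: subset_iff)
  fix B assume B: "Metric_space.mbounded X sup_dist B"
  interpret Y: Metric_space Y sup_dist
    using Metric_space.subspace[OF Metric_space_Hinf Y(2)] .
  obtain M where BX: "B \<subseteq> X" and M: "\<And>f z. f \<in> B \<Longrightarrow> z \<in> ball 0 1 \<Longrightarrow> cmod (f z) \<le> M"
    using mbounded_sup_dist_imp_uniform_bound[OF X B] by metis
  let ?K = "lipschitz_disc (4 * (M / (1 - t)))"
  have sub: "Cesaro t ` B \<subseteq> ?K"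
    using Cesaro_in_lipschitz_disc[OF t] M BX Xhol by blast
  have comp: "compactin Y.mtopology ?K"
    by (rule compactin_lipschitz_disc[OF Y])
  then have "closedin Y.mtopology ?K"
    by (rule compactin_imp_closedin[OF Y.Hausdorff_space_mtopology])
  then have "Y.mtopology closure_of (Cesaro t ` B) \<subseteq> ?K"
    by (rule closure_of_minimal[OF sub])
  then show "compactin Y.mtopology (Y.mtopology closure_of (Cesaro t ` B))"
    by (rule closed_compactin[OF comp]) simp
qed

theorem proposition2p2:
  fixes t :: real
  assumes "0 \<le> t" and "t < 1"
  shows "compact_operator Hinf Hinf (Cesaro t) \<and>
         compact_operator disc_algebra disc_algebra (Cesaro t)"
  using compact_operator_Cesaro[OF assms] disc_algebra_subset_Hinf by blast

end
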